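(* Assume that $0\le p_B<p_A\le1$, put $\pi=p_A-p_B$, and for $\gamma\in(0,1)$ let $(X_n^\gamma)_{n\ge0}$ be the two-armed bandit algorithm with parameters $p_A,p_B$ and constant step $\gamma_n=\gamma$ for all $n\ge1$ (defined in the context), with a.s. limit $X_\infty^\gamma$. Then, for every $x\in(0,1]$, $$\mathbb{P}_x(X_\infty^\gamma=1)\ge1-\frac{2p_A\gamma}{\pi(1-\gamma)^2}\left(\frac1x-1\right),$$ hence $$\lim_{\gamma\to0_+}\mathbb{P}_x(X_\infty^\gamma=1)=1.$$
   Context: Two-armed bandit algorithm with constant step $\gamma\in(0,1)$: let $(U_n)_{n\ge1}$ be i.i.d. random variables uniformly distributed on $[0,1]$, and let $(A_n)_{n\ge1},(B_n)_{n\ge1}$ be events such that $(\mathbf 1_{A_n},\mathbf 1_{B_n})_{n\ge1}$ is an i.i.d. sequence, independent of $(U_n)_{n\ge1}$, with $\mathbb{P}(A_1)=p_A$ and $\mathbb{P}(B_1)=p_B$. The algorithm starting from $x\in[0,1]$ is defined by $X_0^\gamma=x$ and, for $n\ge0$, $$X_{n+1}^\gamma=X_n^\gamma+\gamma\big((1-X_n^\gamma)\mathbf 1_{\{U_{n+1}\le X_n^\gamma\}\cap A_{n+1}}-X_n^\gamma\mathbf 1_{\{U_{n+1}>X_n^\gamma\}\cap B_{n+1}}\big).$$ $\mathbb{P}_x$ denotes probability when $X_0^\gamma=x$. The a.s. limit $X_\infty^\gamma=\lim_nX_n^\gamma$ exists, since $(X_n^\gamma)$ is a $[0,1]$-valued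 submartingale. *)

theory Defs
  imports "HOL-Probability.Probability"
begin

primrec bandit ::
  "(nat \<Rightarrow> 'a \<Rightarrow> real) \<Rightarrow> (nat \<Rightarrow> 'a set) \<Rightarrow> (nat \<Rightarrow> 'a set) \<Rightarrow> real \<Rightarrow> real \<Rightarrow> nat \<Rightarrow> 'a \<Rightarrow> real"
where
  "bandit U A B \<gamma> x 0 = (\<lambda>\<omega>. x)"
| "bandit U A B \<gamma> x (Suc n) = (\<lambda>\<omega>.
     bandit U A B \<gamma> x n \<omega>
     + \<gamma> * ((1 - bandit U A B \<gamma> x n \<omega>)
             * indicator ({\<omega>'. U (Suc n) \<omega>' \<le> bandit U A B \<gamma> x n \<omega>'} \<inter> A (Suc n)) \<omega>
           - bandit U A B \<gamma> x n \<omega>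
             * indicator ({\<omega>'. U (Suc n) \<omega>' > bandit U A B \<gamma> x n \<omega>'} \<inter> B (Suc n)) \<omega>))"

(* The value is only meaningful at those sample points where the path converges. *)
definition bandit_limit ::
  "(nat \<Rightarrow> 'a \<Rightarrow> real) \<Rightarrow> (nat \<Rightarrow> 'a set) \<Rightarrow> (nat \<Rightarrow> 'a set) \<Rightarrow> real \<Rightarrow> real \<Rightarrow> 'a \<Rightarrow> real"
where
  "bandit_limit U A B \<gamma> x \<omega> = lim (\<lambda>n. bandit U A B \<gamma> x n \<omega>)"

definition indicator_pair :: "(nat \<Rightarrow> 'a set) \<Rightarrow> (nat \<Rightarrow> 'a set) \<Rightarrow> nat \<Rightarrow> 'a \<Rightarrow> real \<times> real" where
  "indicator_pair A B n \<omega> = (indicator (A n) \<omega>, indicator (B n) \<omega>)"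

(* The sequences start at index 1; the values at index 0 are unconstrained and never used.
   No dependence structure between A n and B n for the same n is imposed.
   The two sequences have different value types, which indep_var does not allow, so their
   independence is stated as independence of the sigma-algebras they generate. *)
locale bandit_inputs = prob_space M
  for M :: "'a measure" +
  fixes U :: "nat \<Rightarrow> 'a \<Rightarrow> real"
    and A B :: "nat \<Rightarrow> 'a set"
    and p\<^sub>A p\<^sub>B :: real
  assumes U_indep: "indep_vars (\<lambda>_. borel) U {1..}"
    and U_uniform: "\<And>n. n \<ge> 1 \<Longrightarrow> distr M borel (U n) = uniform_measure lborel {0..1}"
    and A_events: "\<And>n. n \<ge> 1 \<Longrightarrow> A n \<in> events"
    and B_events: "\<And>n. n \<ge> 1 \<Longrightarrow> B n \<in> events"
    and AB_indep: "indep_vars (\<lambda>_. borel) (indicator_pair A B) {1..}"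
    and AB_ident: "\<And>n. n \<ge> 1 \<Longrightarrow>
      distr M borel (indicator_pair A B n) = distr M borel (indicator_pair A B 1)"
    and U_AB_indep: "indep_set
      (sets (vimage_algebra (space M) (\<lambda>\<omega>. \<lambda>n\<in>{1..}. U n \<omega>) (\<Pi>\<^sub>M n\<in>{1..}. borel)))
      (sets (vimage_algebra (space M) (\<lambda>\<omega>. \<lambda>n\<in>{1..}. indicator_pair A B n \<omega>) (\<Pi>\<^sub>M n\<in>{1..}. borel)))"
    and prob_A: "prob (A 1) = p\<^sub>A"
    and prob_B: "prob (B 1) = p\<^sub>B"

end

theory Submission
  imports Defs
begin

text \<open>
  Write \<open>X\<^sub>n\<close> for the process and \<open>\<pi> = p\<^sub>A - p\<^sub>B\<close>. Since \<open>E X\<^sub>n\<^sub>+\<^sub>1 - E X\<^sub>n = \<pi> \<gamma> E (X\<^sub>n (1 - X\<^sub>n))\<close>, the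
  series \<open>\<Sum>\<^sub>n X\<^sub>n (1 - X\<^sub>n)\<close> converges almost surely; as the jumps are bounded by \<open>\<gamma> < 1\<close>, the path
  must converge to \<open>0\<close> or to \<open>1\<close>. With \<open>c = 2 p\<^sub>A \<gamma> / (\<pi> (1 - \<gamma>)\<^sup>2)\<close>, the probability of the limit
  \<open>0\<close> is bounded by \<open>\<phi>(x)\<close> for any bounded \<open>\<phi>\<close> with \<open>\<phi>(0+) = 1\<close> and \<open>\<phi>(1) = 0\<close> that is superharmonic
  for the chain. If \<open>c < 1\<close>, the function \<open>min(1, c (1/y - 1))\<close> is one: in the region where it is
  below \<open>1\<close>, already \<open>1/y\<close> is superharmonic. If \<open>c \<ge> 1\<close>, the choice \<open>1 - y\<close> suffices.
\<close>

section \<open>Independence of the noise and of the process\<close>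

text \<open>Boundedness of \<open>f\<close> and \<open>g\<close> makes both factors integrable
  whatever the laws of \<open>X\<close> and \<open>Y\<close> are, so the product rule for
  independent variables applies.\<close>

lemma (in prob_space) indep_varD_expectation_mult:
  assumes "indep_var S X T Y" "f \<in> borel_measurable S" "g \<in> borel_measurable T"
    and "\<And>s. \<bar>f s\<bar> \<le> (K :: real)" "\<And>t. \<bar>g t\<bar> \<le> (L :: real)"
  shows "expectation (\<lambda>\<omega>. f (X \<omega>) * g (Y \<omega>)) = expectation (\<lambda>\<omega>. f (X \<omega>)) * expectation (\<lambda>\<omega>. g (Y \<omega>))"
proof -
  have [measurable]: "X \<in> measurable M S" "Y \<in> measurable M T"
    using assms(1) by (auto dest: indep_var_rv1 indep_var_rv2)
  note [measurable] = assms(2,3)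
  have "indep_var borel (f \<circ> X) borel (g \<circ> Y)"
    using assms by (intro indep_var_compose[OF assms(1)]) auto
  moreover have "integrable M (f \<circ> X)" "integrable M (g \<circ> Y)"
    by (rule integrable_const_bound[where B = K], use assms(4) in simp_all)
       (rule integrable_const_bound[where B = L], use assms(5) in simp_all)
  ultimately show ?thesis
    using indep_var_lebesgue_integral[of "f \<circ> X" "g \<circ> Y"] by simp
qed

text \<open>The empty index set is included because a finite set of noise indices may miss one of
  the two sequences. The second part places the event in the sigma-algebra generated by the whole
  sequence, which is the form that \<open>U_AB_indep\<close> refers to.\<close>

lemma (in prob_space) prob_INT_sequence:
  fixes X :: "nat \<Rightarrow> 'a \<Rightarrow> 'b :: topological_space"
  assumes X: "indep_vars (\<lambda>_. borel) X {1..}" and J: "finite J" "J \<subseteq> {1..}"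
    and S: "\<And>n. n \<in> J \<Longrightarrow> S n \<in> sets borel"
  shows "prob {\<omega> \<in> space M. \<forall>n\<in>J. X n \<omega> \<in> S n} = (\<Prod>n\<in>J. prob {\<omega> \<in> space M. X n \<omega> \<in> S n})"
    and "{\<omega> \<in> space M. \<forall>n\<in>J. X n \<omega> \<in> S n} \<in>
      sets (vimage_algebra (space M) (\<lambda>\<omega>. \<lambda>n\<in>{1..}. X n \<omega>) (\<Pi>\<^sub>M n\<in>{1..}. borel))"
proof -
  have "prob (\<Inter>n\<in>J. X n -` S n \<inter> space M) = (\<Prod>n\<in>J. prob (X n -` S n \<inter> space M))" if "J \<noteq> {}"
    using that X J S by (intro indep_varsD) auto
  moreover have "{\<omega> \<in> space M. X n \<omega> \<in> S n} = X n -` S n \<inter> space M" for n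
    by auto
  moreover have "{\<omega> \<in> space M. \<forall>n\<in>J. X n \<omega> \<in> S n} = (\<Inter>n\<in>J. X n -` S n \<inter> space M)" if "J \<noteq> {}"
    using that by auto
  ultimately show "prob {\<omega> \<in> space M. \<forall>n\<in>J. X n \<omega> \<in> S n} = (\<Prod>n\<in>J. prob {\<omega> \<in> space M. X n \<omega> \<in> S n})"
    by (cases "J = {}") (simp_all add: prob_space)
next
  let ?P = "\<Pi>\<^sub>M n\<in>{1::nat..}. (borel :: 'b measure)"
  let ?R = "\<lambda>\<omega>. \<lambda>n\<in>{1..}. X n \<omega>"
  have "{f \<in> space ?P. \<forall>n\<in>J. f n \<in> S n} \<in> sets ?P"
    using J S by (intro sets.sets_Collect_finite_All) (auto simp: subset_eq)
  hence "?R -` {f \<in> space ?P. \<forall>n\<in>J. f n \<in> S n} \<inter> space M \<in> sets (vimage_algebra (space M) ?R ?P)"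
    by (rule in_vimage_algebra)
  also have "?R -` {f \<in> space ?P. \<forall>n\<in>J. f n \<in> S n} \<inter> space M = {\<omega> \<in> space M. \<forall>n\<in>J. X n \<omega> \<in> S n}"
    using J by (auto simp: space_PiM)
  finally show "{\<omega> \<in> space M. \<forall>n\<in>J. X n \<omega> \<in> S n} \<in> sets (vimage_algebra (space M) ?R ?P)" .
qed

lemma measurable_update:
  fixes s u a b :: "'a \<Rightarrow> real"
  assumes [measurable]: "s \<in> borel_measurable N" "u \<in> borel_measurable N"
      "a \<in> borel_measurable N" "b \<in> borel_measurable N"
  shows "(\<lambda>f. s f + \<gamma> * ((1 - s f) * (of_bool (u f \<le> s f) * a f) - s f * (of_bool (u f > s f) * b f)))
      \<in> borel_measurable N"
  by measurable

context bandit_inputs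
begin

text \<open>A single independent family needs values of one type, so \<open>U\<close> is padded with
  a second coordinate \<open>0\<close>. The two indicators of one step stay together as a pair,
  since they may depend on each other.\<close>

definition noise :: "bool \<times> nat \<Rightarrow> 'a \<Rightarrow> real \<times> real" where
  "noise i \<omega> = (if fst i then (U (snd i) \<omega>, 0) else indicator_pair A B (snd i) \<omega>)"

lemma noise_simps [simp]:
  "noise (True, n) \<omega> = (U n \<omega>, 0)" "noise (False, n) \<omega> = indicator_pair A B n \<omega>"
  by (simp_all add: noise_def)

lemma measurable_U: "n \<ge> 1 \<Longrightarrow> U n \<in> borel_measurable M"
  using U_indep by (auto simp: indep_vars_def)

lemma measurable_indicator_pair: "n \<ge> 1 \<Longrightarrow> indicator_pair A B n \<in> borel_measurable M"
  using AB_indep by (auto simp: indep_vars_def)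

lemma measurable_noise: "n \<ge> 1 \<Longrightarrow> noise (b, n) \<in> borel_measurable M"
proof (cases b)
  assume "n \<ge> 1" "b"
  note [measurable] = measurable_U[OF \<open>n \<ge> 1\<close>]
  have "(\<lambda>\<omega>. (U n \<omega>, 0 :: real)) \<in> borel_measurable M"
    by measurable
  thus ?thesis using \<open>b\<close> by (simp add: noise_def [abs_def])
next
  assume "n \<ge> 1" "\<not> b"
  thus ?thesis using measurable_indicator_pair[of n] by (simp add: noise_def [abs_def])
qed

text \<open>A finite intersection of noise events splits into a part about \<open>U\<close> and a
  part about the indicator pairs. \<open>U_AB_indep\<close> separates these two parts, and each then
  factorises by the independence within its own sequence.\<close>

lemma indep_noise: "indep_vars (\<lambda>_. borel) noise (UNIV \<times> {1..})"
  unfolding indep_vars_def2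
proof (intro conjI ballI)
  fix i :: "bool \<times> nat" assume "i \<in> UNIV \<times> {1..}"
  thus "noise i \<in> borel_measurable M"
    by (cases i) (auto intro: measurable_noise)
next
  show "indep_sets (\<lambda>i. {noise i -` S \<inter> space M |S. S \<in> sets borel}) (UNIV \<times> {1..})"
  proof (rule indep_setsI)
    fix i :: "bool \<times> nat" assume "i \<in> UNIV \<times> {1..}"
    thus "{noise i -` S \<inter> space M |S. S \<in> sets borel} \<subseteq> events"
      by (cases i) (auto intro: measurable_sets[OF measurable_noise])
  next
    fix E and J :: "(bool \<times> nat) set"
    assume J: "J \<noteq> {}" "J \<subseteq> UNIV \<times> {1..}" "finite J"
      and E: "\<forall>j\<in>J. E j \<in> {noise j -` S \<inter> space M |S. S \<in> sets borel}"
    then obtain S where S: "\<And>j. j \<in> J \<Longrightarrow> S j \<in> sets borel"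
      and ES: "\<And>j. j \<in> J \<Longrightarrow> E j = noise j -` S j \<inter> space M"
      by simp metis
    define JU where "JU = {n. (True, n) \<in> J}"
    define JA where "JA = {n. (False, n) \<in> J}"
    have J_eq: "J = Pair True ` JU \<union> Pair False ` JA"
    proof (rule set_eqI)
      fix i show "i \<in> J \<longleftrightarrow> i \<in> Pair True ` JU \<union> Pair False ` JA"
        by (cases i; cases "fst i") (auto simp: JU_def JA_def)
    qed
    have fin: "finite JU" "finite JA"
      using J(3) unfolding J_eq by (auto dest: finite_imageD simp: inj_on_def)
    have sub: "JU \<subseteq> {1..}" "JA \<subseteq> {1..}"
      using J(2) by (auto simp: JU_def JA_def)
    \<comment> \<open>Pulling back along the padding map turns a condition on the padded value into
      one on \<open>U n\<close> alone.\<close>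
    define T where "T n = (\<lambda>u. (u, 0 :: real)) -` S (True, n)" for n
    have T: "T n \<in> sets borel" if "n \<in> JU" for n
    proof -
      have "(\<lambda>u. (u, 0 :: real)) -` S (True, n) \<inter> space borel \<in> sets (borel :: real measure)"
        using that S by (intro measurable_sets[of _ borel borel]) (auto simp: JU_def)
      thus ?thesis by (simp add: T_def)
    qed
    have S': "S (False, n) \<in> sets borel" if "n \<in> JA" for n
      using that S by (auto simp: JA_def)
    have "(\<Inter>j\<in>J. E j) = {\<omega> \<in> space M. \<forall>j\<in>J. noise j \<omega> \<in> S j}"
      using J(1) ES by auto
    also have "\<dots> = {\<omega> \<in> space M. \<forall>n\<in>JU. U n \<omega> \<in> T n} \<inter>
        {\<omega> \<in> space M. \<forall>n\<in>JA. indicator_pair A B n \<omega> \<in> S (False, n)}"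
      by (auto simp: J_eq ball_Un T_def)
    finally have "prob (\<Inter>j\<in>J. E j) = prob {\<omega> \<in> space M. \<forall>n\<in>JU. U n \<omega> \<in> T n} *
        prob {\<omega> \<in> space M. \<forall>n\<in>JA. indicator_pair A B n \<omega> \<in> S (False, n)}"
      using indep_setD[OF U_AB_indep
          prob_INT_sequence(2)[OF U_indep fin(1) sub(1) T] prob_INT_sequence(2)[OF AB_indep fin(2) sub(2) S']]
      by simp
    also have "\<dots> = (\<Prod>n\<in>JU. prob {\<omega> \<in> space M. U n \<omega> \<in> T n}) *
        (\<Prod>n\<in>JA. prob {\<omega> \<in> space M. indicator_pair A B n \<omega> \<in> S (False, n)})"
      by (simp only: prob_INT_sequence(1)[OF U_indep fin(1) sub(1) T] prob_INT_sequence(1)[OF AB_indep fin(2) sub(2) S'])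
    also have "(\<Prod>n\<in>JU. prob {\<omega> \<in> space M. U n \<omega> \<in> T n}) = (\<Prod>j\<in>Pair True ` JU. prob (E j))"
      by (subst prod.reindex)
         (auto simp: inj_on_def ES JU_def T_def vimage_def Int_def conj_commute intro!: prod.cong)
    also have "(\<Prod>n\<in>JA. prob {\<omega> \<in> space M. indicator_pair A B n \<omega> \<in> S (False, n)}) =
        (\<Prod>j\<in>Pair False ` JA. prob (E j))"
      by (subst prod.reindex)
         (auto simp: inj_on_def ES JA_def vimage_def Int_def conj_commute intro!: prod.cong)
    also have "(\<Prod>j\<in>Pair True ` JU. prob (E j)) * (\<Prod>j\<in>Pair False ` JA. prob (E j)) = (\<Prod>j\<in>J. prob (E j))"
      unfolding J_eq using fin by (subst prod.union_disjoint) auto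
    finally show "prob (\<Inter>j\<in>J. E j) = (\<Prod>j\<in>J. prob (E j))" .
  qed
qed

text \<open>The indicator pairs have equal laws by \<open>AB_ident\<close>, and the events are the
  preimages of \<open>{1} \<times> UNIV\<close> and \<open>UNIV \<times> {1}\<close> under
  them.\<close>

lemma prob_A_B:
  assumes "n \<ge> 1"
  shows "prob (A n) = p\<^sub>A" "prob (B n) = p\<^sub>B"
proof -
  have *: "prob (indicator_pair A B n -` S \<inter> space M) = prob (indicator_pair A B 1 -` S \<inter> space M)"
    if "S \<in> sets borel" for S
    using that arg_cong[OF AB_ident[OF assms], of "\<lambda>D. measure D S"]
      measurable_indicator_pair[OF assms] measurable_indicator_pair[of 1]
    by (simp add: measure_distr)
  have eq: "A k = indicator_pair A B k -` ({1} \<times> UNIV) \<inter> space M"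
    "B k = indicator_pair A B k -` (UNIV \<times> {1}) \<inter> space M" if "k \<ge> 1" for k
    using A_events[OF that] B_events[OF that] sets.sets_into_space
    by (auto simp: indicator_pair_def indicator_def split: if_splits)
  show "prob (A n) = p\<^sub>A" "prob (B n) = p\<^sub>B"
    using *[of "{1} \<times> UNIV"] *[of "UNIV \<times> {1}"] assms
    by (simp_all add: eq[symmetric] prob_A prob_B borel_closed closed_Times del: One_nat_def)
qed

text \<open>The state at time \<open>n\<close> as a function of the noise alone, so that its independence from
  later noise can be read off.\<close>

primrec state_of :: "real \<Rightarrow> real \<Rightarrow> nat \<Rightarrow> (bool \<times> nat \<Rightarrow> real \<times> real) \<Rightarrow> real" where
  "state_of \<gamma> x 0 f = x"
| "state_of \<gamma> x (Suc n) f = state_of \<gamma> x n f +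
     \<gamma> * ((1 - state_of \<gamma> x n f) *
             (of_bool (fst (f (True, Suc n)) \<le> state_of \<gamma> x n f) * fst (f (False, Suc n)))
          - state_of \<gamma> x n f *
             (of_bool (fst (f (True, Suc n)) > state_of \<gamma> x n f) * snd (f (False, Suc n))))"

text \<open>The process at time \<open>n\<close> reads the noise with time index from 1 to
  \<open>n\<close>, so \<open>f\<close> may be the restriction of \<open>noise\<close> to any index
  set that contains this block.\<close>

lemma bandit_eq_state_of:
  assumes "\<And>b k. 1 \<le> k \<Longrightarrow> k \<le> n \<Longrightarrow> f (b, k) = noise (b, k) \<omega>"
  shows "bandit U A B \<gamma> x n \<omega> = state_of \<gamma> x n f"
  using assms
proof (induction n)
  case (Suc n)
  have "bandit U A B \<gamma> x n \<omega> = state_of \<gamma> x n f"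
    by (rule Suc.IH) (use Suc.prems in auto)
  thus ?case
    using Suc.prems[of "Suc n" True] Suc.prems[of "Suc n" False]
    by (auto simp: indicator_pair_def indicator_def)
qed simp

lemma measurable_state_of:
  assumes "UNIV \<times> {1..n} \<subseteq> I"
  shows "state_of \<gamma> x n \<in> borel_measurable (PiM I (\<lambda>_. borel))"
  using assms
proof (induction n)
  case (Suc n)
  have "state_of \<gamma> x n \<in> borel_measurable (PiM I (\<lambda>_. borel))"
    by (rule Suc.IH) (use Suc.prems in auto)
  have "(\<lambda>f. f (b, Suc n)) \<in> measurable (PiM I (\<lambda>_. borel :: (real \<times> real) measure)) borel" for b
    using Suc.prems by (intro measurable_component_singleton) auto
  from measurable_compose[OF this, of fst borel] measurable_compose[OF this, of snd borel]
  have
    "(\<lambda>f. fst (f (b, Suc n))) \<in> borel_measurable (PiM I (\<lambda>_. borel :: (real \<times> real) measure))"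
    "(\<lambda>f. snd (f (b, Suc n))) \<in> borel_measurable (PiM I (\<lambda>_. borel :: (real \<times> real) measure))" for b
    by (auto simp: borel_prod[symmetric])
  with \<open>state_of \<gamma> x n \<in> _\<close> show ?case
    unfolding state_of.simps by (intro measurable_update) simp_all
next
  case 0
  have "state_of \<gamma> x 0 = (\<lambda>_. x)"
    by auto
  thus ?case
    by simp
qed

lemma measurable_bandit [measurable]: "bandit U A B \<gamma> x n \<in> borel_measurable M"
proof -
  have "(\<lambda>\<omega>. state_of \<gamma> x n (\<lambda>i\<in>UNIV \<times> {1..n}. noise i \<omega>)) \<in> borel_measurable M"
    by (rule measurable_compose[OF measurable_restrict measurable_state_of])
       (auto intro: measurable_noise)
  moreover have "state_of \<gamma> x n (\<lambda>i\<in>UNIV \<times> {1..n}. noise i \<omega>) = bandit U A B \<gamma> x n \<omega>" for \<omega>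
    by (rule bandit_eq_state_of[symmetric]) auto
  ultimately show ?thesis by simp
qed

text \<open>The state is a function of the noise up to time \<open>n\<close>, and the index of
  \<open>U (Suc n)\<close> lies outside that block; functions of disjoint blocks of an independent
  family are independent.\<close>

lemma indep_bandit_U: "indep_var borel (bandit U A B \<gamma> x n) borel (U (Suc n))"
proof -
  let ?I = "UNIV \<times> {1..n}" and ?J = "{(True, Suc n)}"
  have "indep_var borel (state_of \<gamma> x n \<circ> (\<lambda>\<omega>. \<lambda>i\<in>?I. noise i \<omega>))
          borel ((\<lambda>f. fst (f (True, Suc n))) \<circ> (\<lambda>\<omega>. \<lambda>i\<in>?J. noise i \<omega>))"
  proof (rule indep_var_compose[OF indep_var_restrict[OF indep_noise]])
    show "(\<lambda>f. fst (f (True, Suc n))) \<in> borel_measurable (PiM ?J (\<lambda>_. borel :: (real \<times> real) measure))"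
      by (rule measurable_compose[OF measurable_component_singleton]) (auto simp: borel_prod[symmetric])
  qed (auto intro: measurable_state_of)
  moreover have "state_of \<gamma> x n \<circ> (\<lambda>\<omega>. \<lambda>i\<in>?I. noise i \<omega>) = bandit U A B \<gamma> x n"
    by (rule ext, simp only: o_apply, rule bandit_eq_state_of[symmetric]) auto
  ultimately show ?thesis by (simp add: comp_def)
qed

text \<open>The block of the past is enlarged by the next uniform variable, because the choice of
  the arm depends jointly on the state and on that variable.\<close>

lemma indep_bandit_U_AB:
  "indep_var (borel \<Otimes>\<^sub>M borel) (\<lambda>\<omega>. (bandit U A B \<gamma> x n \<omega>, U (Suc n) \<omega>))
     borel (indicator_pair A B (Suc n))"
proof -
  let ?I = "UNIV \<times> {1..n} \<union> {(True, Suc n)}" and ?J = "{(False, Suc n)}"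
  let ?f = "\<lambda>f. (state_of \<gamma> x n f, fst (f (True, Suc n)))"
  have "indep_var (borel \<Otimes>\<^sub>M borel) (?f \<circ> (\<lambda>\<omega>. \<lambda>i\<in>?I. noise i \<omega>))
          borel ((\<lambda>f. f (False, Suc n)) \<circ> (\<lambda>\<omega>. \<lambda>i\<in>?J. noise i \<omega>))"
  proof (rule indep_var_compose[OF indep_var_restrict[OF indep_noise]])
    have "(\<lambda>f. fst (f (True, Suc n))) \<in> borel_measurable (PiM ?I (\<lambda>_. borel :: (real \<times> real) measure))"
      by (rule measurable_compose[OF measurable_component_singleton]) (auto simp: borel_prod[symmetric])
    thus "?f \<in> measurable (PiM ?I (\<lambda>_. borel :: (real \<times> real) measure)) (borel \<Otimes>\<^sub>M borel)"
      by (intro measurable_Pair measurable_state_of) auto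
    show "(\<lambda>f. f (False, Suc n)) \<in> borel_measurable (PiM ?J (\<lambda>_. borel :: (real \<times> real) measure))"
      by (rule measurable_component_singleton) auto
  qed auto
  moreover have "state_of \<gamma> x n (\<lambda>i\<in>?I. noise i \<omega>) = bandit U A B \<gamma> x n \<omega>" for \<omega>
    by (rule bandit_eq_state_of[symmetric]) auto
  ultimately show ?thesis by (simp add: comp_def)
qed

end

section \<open>Expectations over one step\<close>

lemma integral_uniform_unit_interval:
  assumes "0 \<le> (y :: real)" "y \<le> 1"
  shows "(\<integral>u. of_bool (u \<le> y) \<partial>uniform_measure lborel {0..1}) = y"
    and "(\<integral>u. of_bool (y < u) \<partial>uniform_measure lborel {0..1}) = 1 - y"
proof -
  have "(\<lambda>u. of_bool (u \<le> y) :: real) = indicator {..y}" "(\<lambda>u. of_bool (y < u) :: real) = indicator {y<..}"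
    by (auto simp: indicator_def)
  moreover have "{0..1} \<inter> {..y} = {0..y}" "{0..1} \<inter> {y<..} = {y<..1}"
    using assms by auto
  ultimately show "(\<integral>u. of_bool (u \<le> y) \<partial>uniform_measure lborel {0..1}) = y"
    and "(\<integral>u. of_bool (y < u) \<partial>uniform_measure lborel {0..1}) = 1 - y"
    using assms by simp_all
qed

context bandit_inputs
begin

lemma bandit_Suc_cases:
  obtains (stay) "bandit U A B \<gamma> x (Suc n) \<omega> = bandit U A B \<gamma> x n \<omega>"
  | (up) "bandit U A B \<gamma> x (Suc n) \<omega> = bandit U A B \<gamma> x n \<omega> + \<gamma> * (1 - bandit U A B \<gamma> x n \<omega>)"
  | (down) "bandit U A B \<gamma> x (Suc n) \<omega> = bandit U A B \<gamma> x n \<omega> - \<gamma> * bandit U A B \<gamma> x n \<omega>"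
  by (cases "U (Suc n) \<omega> \<le> bandit U A B \<gamma> x n \<omega>"; cases "\<omega> \<in> A (Suc n)"; cases "\<omega> \<in> B (Suc n)")
     (auto simp: indicator_def)

text \<open>Each move covers the fraction \<gamma> < 1 of the distance to an endpoint. A downward
  move keeps the fraction \<open>1 - \<gamma>\<close> of the state, so positivity persists, which
  later makes \<open>1 / y\<close> usable along the path.\<close>

lemma bandit_range:
  assumes "0 < \<gamma>" "\<gamma> < 1" "0 < x" "x \<le> 1"
  shows "0 < bandit U A B \<gamma> x n \<omega> \<and> bandit U A B \<gamma> x n \<omega> \<le> 1"
proof (induction n)
  case (Suc n)
  let ?y = "bandit U A B \<gamma> x n \<omega>"
  have up: "0 \<le> \<gamma> * (1 - ?y)" "\<gamma> * (1 - ?y) \<le> 1 - ?y"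
    using Suc assms by (auto intro: mult_left_le_one_le)
  have down: "0 < \<gamma> * ?y" "\<gamma> * ?y < ?y"
    using Suc assms by auto
  show ?case
    by (cases rule: bandit_Suc_cases[of \<gamma> x n \<omega>]; use Suc up down in linarith)
qed (use assms in simp)

text \<open>By independence the joint law of the state and the next uniform variable is a product
  measure, and Fubini integrates out the uniform variable with the state held fixed.\<close>

lemma expectation_bandit_U:
  fixes g :: "real \<times> real \<Rightarrow> real"
  assumes g [measurable]: "g \<in> borel_measurable (borel \<Otimes>\<^sub>M borel)" and K: "\<And>z. \<bar>g z\<bar> \<le> K"
  shows "expectation (\<lambda>\<omega>. g (bandit U A B \<gamma> x n \<omega>, U (Suc n) \<omega>)) =
    expectation (\<lambda>\<omega>. \<integral>u. g (bandit U A B \<gamma> x n \<omega>, u) \<partial>uniform_measure lborel {0..1})"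
proof -
  let ?X = "bandit U A B \<gamma> x n"
  let ?D = "distr M borel ?X" and ?E = "distr M borel (U (Suc n))"
  have [measurable]: "U (Suc n) \<in> borel_measurable M"
    by (rule measurable_U) simp
  interpret D: prob_space ?D by (rule prob_space_distr) measurable
  interpret E: prob_space ?E by (rule prob_space_distr) measurable
  interpret DE: pair_prob_space ?D ?E ..
  have eq: "distr M (borel \<Otimes>\<^sub>M borel) (\<lambda>\<omega>. (?X \<omega>, U (Suc n) \<omega>)) = ?D \<Otimes>\<^sub>M ?E"
    using indep_bandit_U by (subst (asm) indep_var_distribution_eq) simp
  have "expectation (\<lambda>\<omega>. g (?X \<omega>, U (Suc n) \<omega>)) = integral\<^sup>L (?D \<Otimes>\<^sub>M ?E) g"
    unfolding eq[symmetric] by (subst integral_distr) simp_all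
  also have "\<dots> = (\<integral>y. \<integral>u. g (y, u) \<partial>?E \<partial>?D)"
    by (subst DE.integral_fst')
       (auto intro!: DE.integrable_const_bound[where B = K] simp: K)
  also have "\<dots> = expectation (\<lambda>\<omega>. \<integral>u. g (?X \<omega>, u) \<partial>?E)"
    by (rule integral_distr) simp_all
  finally show ?thesis
    by (simp add: U_uniform)
qed

text \<open>Two independences are used in turn: the indicator of the event is split off first and
  contributes its probability, then the uniform variable is integrated out and contributes the
  probability of choosing that arm.\<close>

lemma expectation_arms:
  fixes n :: nat
  assumes x: "0 < \<gamma>" "\<gamma> < 1" "0 < x" "x \<le> 1"
    and g [measurable]: "g \<in> borel_measurable borel" and K: "\<And>y. \<bar>g y :: real\<bar> \<le> K"
  defines "X \<equiv> bandit U A B \<gamma> x n"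
  shows "expectation (\<lambda>\<omega>. g (X \<omega>) * of_bool (U (Suc n) \<omega> \<le> X \<omega>) * indicator (A (Suc n)) \<omega>) =
      p\<^sub>A * expectation (\<lambda>\<omega>. X \<omega> * g (X \<omega>))"
    and "expectation (\<lambda>\<omega>. g (X \<omega>) * of_bool (X \<omega> < U (Suc n) \<omega>) * indicator (B (Suc n)) \<omega>) =
      p\<^sub>B * expectation (\<lambda>\<omega>. (1 - X \<omega>) * g (X \<omega>))"
proof -
  have K': "\<bar>g y * of_bool b\<bar> \<le> K" for y b
    using K[of y] by (cases b) auto
  have prob_AB: "prob (A (Suc n) \<inter> space M) = p\<^sub>A" "prob (B (Suc n) \<inter> space M) = p\<^sub>B"
    using A_events[of "Suc n"] B_events[of "Suc n"] by (simp_all add: prob_A_B)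
  \<comment> \<open>The product rule is applied to functions bounded on the whole plane; truncation
    to the unit interval bounds the coordinates and leaves indicators unchanged.\<close>
  let ?c = "\<lambda>t. max 0 (min 1 (t :: real))"
  have clip: "?c (indicator S \<omega>) = indicator S \<omega>" for S :: "'a set" and \<omega>
    by (simp add: indicator_def)
  have fst: "(\<lambda>z. ?c (fst z)) \<in> borel_measurable (borel :: (real \<times> real) measure)"
    and snd: "(\<lambda>z. ?c (snd z)) \<in> borel_measurable (borel :: (real \<times> real) measure)"
    unfolding borel_prod[symmetric] by measurable
  have "expectation (\<lambda>\<omega>. g (X \<omega>) * of_bool (U (Suc n) \<omega> \<le> X \<omega>) * indicator (A (Suc n)) \<omega>) =
      expectation (\<lambda>\<omega>. g (X \<omega>) * of_bool (U (Suc n) \<omega> \<le> X \<omega>)) * p\<^sub>A"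
    using indep_varD_expectation_mult[OF indep_bandit_U_AB[of \<gamma> x n],
        of "\<lambda>(y, u). g y * of_bool (u \<le> y)" "\<lambda>z. ?c (fst z)" K 1] fst K'
    by (simp add: X_def prob_AB indicator_pair_def clip split_beta)
  also have "expectation (\<lambda>\<omega>. g (X \<omega>) * of_bool (U (Suc n) \<omega> \<le> X \<omega>)) = expectation (\<lambda>\<omega>. X \<omega> * g (X \<omega>))"
    using expectation_bandit_U[of "\<lambda>(y, u). g y * of_bool (u \<le> y)" K \<gamma> x n] K' bandit_range[OF x]
    by (simp add: X_def integral_uniform_unit_interval less_imp_le mult.commute split_beta)
  finally show "expectation (\<lambda>\<omega>. g (X \<omega>) * of_bool (U (Suc n) \<omega> \<le> X \<omega>) * indicator (A (Suc n)) \<omega>) =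
      p\<^sub>A * expectation (\<lambda>\<omega>. X \<omega> * g (X \<omega>))" by simp
  have "expectation (\<lambda>\<omega>. g (X \<omega>) * of_bool (X \<omega> < U (Suc n) \<omega>) * indicator (B (Suc n)) \<omega>) =
      expectation (\<lambda>\<omega>. g (X \<omega>) * of_bool (X \<omega> < U (Suc n) \<omega>)) * p\<^sub>B"
    using indep_varD_expectation_mult[OF indep_bandit_U_AB[of \<gamma> x n],
        of "\<lambda>(y, u). g y * of_bool (y < u)" "\<lambda>z. ?c (snd z)" K 1] snd K'
    by (simp add: X_def prob_AB indicator_pair_def clip split_beta)
  also have "expectation (\<lambda>\<omega>. g (X \<omega>) * of_bool (X \<omega> < U (Suc n) \<omega>)) = expectation (\<lambda>\<omega>. (1 - X \<omega>) * g (X \<omega>))"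
    using expectation_bandit_U[of "\<lambda>(y, u). g y * of_bool (y < u)" K \<gamma> x n] K' bandit_range[OF x]
    by (simp add: X_def integral_uniform_unit_interval less_imp_le mult.commute split_beta)
  finally show "expectation (\<lambda>\<omega>. g (X \<omega>) * of_bool (X \<omega> < U (Suc n) \<omega>) * indicator (B (Suc n)) \<omega>) =
      p\<^sub>B * expectation (\<lambda>\<omega>. (1 - X \<omega>) * g (X \<omega>))" by simp
qed

text \<open>The right-hand integrand is \<open>\<phi>\<close> plus the generator of the chain
  applied to \<open>\<phi>\<close>. Pointwise (in)equalities for the generator thus turn into
  statements about expectations, without conditional expectations.\<close>

lemma expectation_bandit_Suc:
  fixes n :: nat
  assumes x: "0 < \<gamma>" "\<gamma> < 1" "0 < x" "x \<le> 1"
    and \<phi> [measurable]: "\<phi> \<in> borel_measurable borel" and K: "\<And>y. \<bar>\<phi> y :: real\<bar> \<le> K"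
  defines "X \<equiv> bandit U A B \<gamma> x"
  shows "expectation (\<lambda>\<omega>. \<phi> (X (Suc n) \<omega>)) = expectation (\<lambda>\<omega>. \<phi> (X n \<omega>)
    + p\<^sub>A * (X n \<omega> * (\<phi> (X n \<omega> + \<gamma> * (1 - X n \<omega>)) - \<phi> (X n \<omega>)))
    + p\<^sub>B * ((1 - X n \<omega>) * (\<phi> (X n \<omega> - \<gamma> * X n \<omega>) - \<phi> (X n \<omega>))))"
proof -
  define u where "u y = \<phi> (y + \<gamma> * (1 - y)) - \<phi> y" for y
  define d where "d y = \<phi> (y - \<gamma> * y) - \<phi> y" for y
  have [measurable]: "u \<in> borel_measurable borel" "d \<in> borel_measurable borel"
    unfolding u_def d_def by measurable
  have Ku: "\<bar>u y\<bar> \<le> 2 * K" and Kd: "\<bar>d y\<bar> \<le> 2 * K" for y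
    using K[of y] K[of "y + \<gamma> * (1 - y)"] K[of "y - \<gamma> * y"] unfolding u_def d_def by linarith+
  have [measurable]: "X n \<in> borel_measurable M"
    unfolding X_def by measurable
  have [measurable]: "A (Suc n) \<in> events" "B (Suc n) \<in> events" "U (Suc n) \<in> borel_measurable M"
    using A_events B_events measurable_U by auto
  have range: "0 < X n \<omega>" "X n \<omega> \<le> 1" for \<omega>
    using bandit_range[OF x] by (simp_all add: X_def)
  have K0: "0 \<le> K" using K[of 0] by linarith
  let ?up = "\<lambda>\<omega>. u (X n \<omega>) * of_bool (U (Suc n) \<omega> \<le> X n \<omega>) * indicator (A (Suc n)) \<omega>"
  let ?down = "\<lambda>\<omega>. d (X n \<omega>) * of_bool (X n \<omega> < U (Suc n) \<omega>) * indicator (B (Suc n)) \<omega>"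
  \<comment> \<open>The two conditions on \<open>U (Suc n)\<close> exclude each other, so at most
    one increment is nonzero.\<close>
  have "\<phi> (X (Suc n) \<omega>) = \<phi> (X n \<omega>) + ?up \<omega> + ?down \<omega>" for \<omega>
    by (auto simp: X_def u_def d_def indicator_def not_le)
  hence "expectation (\<lambda>\<omega>. \<phi> (X (Suc n) \<omega>)) = expectation (\<lambda>\<omega>. \<phi> (X n \<omega>) + ?up \<omega> + ?down \<omega>)"
    by simp
  also have "\<dots> = expectation (\<lambda>\<omega>. \<phi> (X n \<omega>)) + expectation ?up + expectation ?down"
  proof -
    have "integrable M (\<lambda>\<omega>. \<phi> (X n \<omega>))"
      by (rule integrable_const_bound[where B = K]) (use K in auto)
    moreover have "integrable M ?up"
      by (rule integrable_const_bound[where B = "2 * K"]) (use Ku K0 in \<open>auto simp: indicator_def\<close>)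
    moreover have "integrable M ?down"
      by (rule integrable_const_bound[where B = "2 * K"]) (use Kd K0 in \<open>auto simp: indicator_def\<close>)
    ultimately show ?thesis by simp
  qed
  also have "expectation ?up = p\<^sub>A * expectation (\<lambda>\<omega>. X n \<omega> * u (X n \<omega>))"
    unfolding X_def by (rule expectation_arms[OF x _ Ku]) measurable
  also have "expectation ?down = p\<^sub>B * expectation (\<lambda>\<omega>. (1 - X n \<omega>) * d (X n \<omega>))"
    unfolding X_def by (rule expectation_arms[OF x _ Kd]) measurable
  also have "expectation (\<lambda>\<omega>. \<phi> (X n \<omega>)) + p\<^sub>A * expectation (\<lambda>\<omega>. X n \<omega> * u (X n \<omega>)) +
      p\<^sub>B * expectation (\<lambda>\<omega>. (1 - X n \<omega>) * d (X n \<omega>)) =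
      expectation (\<lambda>\<omega>. \<phi> (X n \<omega>) + p\<^sub>A * (X n \<omega> * u (X n \<omega>)) + p\<^sub>B * ((1 - X n \<omega>) * d (X n \<omega>)))"
  proof -
    have "\<bar>X n \<omega> * u (X n \<omega>)\<bar> \<le> 1 * (2 * K)" "\<bar>(1 - X n \<omega>) * d (X n \<omega>)\<bar> \<le> 1 * (2 * K)" for \<omega>
      unfolding abs_mult using range[of \<omega>] Ku[of "X n \<omega>"] Kd[of "X n \<omega>"] by (intro mult_mono; simp)+
    note bounds = this
    have "integrable M (\<lambda>\<omega>. \<phi> (X n \<omega>))"
      by (rule integrable_const_bound[where B = K]) (use K in auto)
    moreover have "integrable M (\<lambda>\<omega>. X n \<omega> * u (X n \<omega>))"
      by (rule integrable_const_bound[where B = "1 * (2 * K)"])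
         (use bounds in simp_all)
    moreover have "integrable M (\<lambda>\<omega>. (1 - X n \<omega>) * d (X n \<omega>))"
      by (rule integrable_const_bound[where B = "1 * (2 * K)"])
         (use bounds in simp_all)
    ultimately show ?thesis by simp
  qed
  finally show ?thesis by (simp add: u_def d_def)
qed

end

section \<open>Deterministic convergence to an endpoint\<close>

text \<open>For \<open>y n \<le> 1 / 2\<close> the factor \<open>2 * (1 - y n)\<close> is at least
  1, so \<open>y n\<close> is dominated by twice the product. The case of the endpoint 1 reduces to
  this one by reflection.\<close>

lemma LIMSEQ_trapped_near_0:
  fixes y :: "nat \<Rightarrow> real"
  assumes range: "\<And>n. 0 \<le> y n \<and> y n \<le> 1"
    and lim: "(\<lambda>n. y n * (1 - y n)) \<longlonglongrightarrow> 0"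
    and near: "eventually (\<lambda>n. y n \<le> 1 / 2) sequentially"
  shows "y \<longlonglongrightarrow> 0"
proof (rule tendsto_sandwich[where f = "\<lambda>_. 0"])
  show "(\<lambda>n. 2 * (y n * (1 - y n))) \<longlonglongrightarrow> 0"
    using tendsto_mult_right_zero[OF lim, of 2] by simp
  show "eventually (\<lambda>n. y n \<le> 2 * (y n * (1 - y n))) sequentially"
    using near
  proof eventually_elim
    case (elim n)
    hence "y n * 1 \<le> y n * (2 * (1 - y n))"
      using range[of n] by (intro mult_left_mono) auto
    thus ?case by (simp add: algebra_simps)
  qed
  show "eventually (\<lambda>n. 0 \<le> y n) sequentially"
    using range by simp
qed simp

text \<open>Once \<open>y n * (1 - y n)\<close> is small, \<open>y n\<close> is close to an endpoint of the unit interval, and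
  a jump of size at most \<open>\<gamma> < 1\<close> cannot take it to the vicinity of the other one.\<close>

lemma LIMSEQ_0_or_1:
  fixes y :: "nat \<Rightarrow> real"
  assumes range: "\<And>n. 0 \<le> y n \<and> y n \<le> 1"
    and jump: "\<And>n. \<bar>y (Suc n) - y n\<bar> \<le> \<gamma>" and \<gamma>: "\<gamma> < 1"
    and lim: "(\<lambda>n. y n * (1 - y n)) \<longlonglongrightarrow> 0"
  shows "y \<longlonglongrightarrow> 0 \<or> y \<longlonglongrightarrow> 1"
proof -
  \<comment> \<open>The middle interval from \<open>e\<close> to \<open>1 - e\<close> has length
    exactly \<gamma>, so a jump that starts strictly below \<open>e\<close> ends strictly below
    \<open>1 - e\<close>, and symmetrically from above.\<close>
  define e where "e = (1 - \<gamma>) / 2"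
  have "0 \<le> \<gamma>" using jump[of 0] by linarith
  hence e: "0 < e" "e \<le> 1 / 2" "e + \<gamma> = 1 - e"
    using \<gamma> by (auto simp: e_def field_simps)
  hence "0 < e * (1 - e)" by (intro mult_pos_pos) auto
  from order_tendstoD(2)[OF lim this]
  obtain N where N: "\<And>n. n \<ge> N \<Longrightarrow> y n * (1 - y n) < e * (1 - e)"
    by (auto simp: eventually_sequentially)
  have extreme: "y n < e \<or> y n > 1 - e" if "n \<ge> N" for n
  proof (rule ccontr)
    assume "\<not> ?thesis"
    \<comment> \<open>The product equals \<open>y n * (1 - y n) - e * (1 - e)\<close>, which is
      negative by the choice of \<open>N\<close>.\<close>
    hence "0 \<le> (y n - e) * (1 - e - y n)"
      by (intro mult_nonneg_nonneg) auto
    with N[OF that] show False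
      by (simp add: algebra_simps)
  qed
  have low: "y n < e" if "y N < e" "n \<ge> N" for n
    using that(2)
  proof (induction n rule: dec_induct)
    case (step n)
    thus ?case using extreme[of "Suc n"] jump[of n] e by linarith
  qed (use that in simp)
  have high: "y n > 1 - e" if "y N > 1 - e" "n \<ge> N" for n
    using that(2)
  proof (induction n rule: dec_induct)
    case (step n)
    thus ?case using extreme[of "Suc n"] jump[of n] e by linarith
  qed (use that in simp)
  show ?thesis
  proof (cases "y N < e")
    case True
    have "y \<longlonglongrightarrow> 0"
    proof (rule LIMSEQ_trapped_near_0[OF range lim])
      show "eventually (\<lambda>n. y n \<le> 1 / 2) sequentially"
        using eventually_ge_at_top[of N] by eventually_elim (use low[OF True] e in fastforce)
    qed
    thus ?thesis ..
  next
    case False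
    hence *: "y N > 1 - e" using extreme[of N] by simp
    have "(\<lambda>n. 1 - y n) \<longlonglongrightarrow> 0"
    proof (rule LIMSEQ_trapped_near_0)
      show "eventually (\<lambda>n. 1 - y n \<le> 1 / 2) sequentially"
        using eventually_ge_at_top[of N] by eventually_elim (use high[OF *] e in fastforce)
    qed (use range lim in \<open>auto simp: mult.commute\<close>)
    from tendsto_diff[OF tendsto_const[of 1] this] show ?thesis by simp
  qed
qed

section \<open>Almost sure convergence and the supermartingale bound\<close>

context bandit_inputs
begin

text \<open>For the identity as test function, both arms contribute a multiple of the same product
  \<open>X n \<omega> * (1 - X n \<omega>)\<close>, with coefficients of opposite sign; the
  increments of the expectation then telescope.\<close>

lemma expectation_bandit_drift:
  assumes x: "0 < \<gamma>" "\<gamma> < 1" "0 < x" "x \<le> 1"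
  defines "X \<equiv> bandit U A B \<gamma> x"
  shows "(p\<^sub>A - p\<^sub>B) * \<gamma> * (\<Sum>k<n. expectation (\<lambda>\<omega>. X k \<omega> * (1 - X k \<omega>))) = expectation (X n) - x"
proof (induction n)
  case 0
  show ?case by (simp add: X_def prob_space)
next
  case (Suc n)
  have [measurable]: "X n \<in> borel_measurable M" for n
    unfolding X_def by measurable
  \<comment> \<open>The one-step formula asks for a bounded test function, so the identity is
    truncated to the unit interval, where all the states involved lie.\<close>
  let ?c = "\<lambda>y::real. max 0 (min 1 y)"
  have range: "0 < X n \<omega>" "X n \<omega> \<le> 1" for n \<omega>
    using bandit_range[OF x] by (simp_all add: X_def)
  have clip: "?c (X n \<omega>) = X n \<omega>" "?c (X n \<omega> + \<gamma> * (1 - X n \<omega>)) = X n \<omega> + \<gamma> * (1 - X n \<omega>)"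
    "?c (X n \<omega> - \<gamma> * X n \<omega>) = X n \<omega> - \<gamma> * X n \<omega>" for n \<omega>
  proof -
    have "0 \<le> \<gamma> * (1 - X n \<omega>)" "\<gamma> * (1 - X n \<omega>) \<le> 1 - X n \<omega>" "0 \<le> \<gamma> * X n \<omega>" "\<gamma> * X n \<omega> \<le> X n \<omega>"
      using range[of n \<omega>] x by (auto intro: mult_left_le_one_le)
    thus "?c (X n \<omega>) = X n \<omega>" "?c (X n \<omega> + \<gamma> * (1 - X n \<omega>)) = X n \<omega> + \<gamma> * (1 - X n \<omega>)"
      "?c (X n \<omega> - \<gamma> * X n \<omega>) = X n \<omega> - \<gamma> * X n \<omega>"
      using range[of n \<omega>] by linarith+
  qed
  have int: "integrable M (X n)"
    by (rule integrable_const_bound[where B = 1]) (use range less_imp_le[OF range(1)] in auto)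
  have int': "integrable M (\<lambda>\<omega>. X n \<omega> * (1 - X n \<omega>))"
    by (rule integrable_const_bound[where B = 1])
       (use range less_imp_le[OF range(1)] in \<open>auto simp: abs_mult intro!: mult_le_one\<close>)
  have "expectation (X (Suc n)) = expectation (\<lambda>\<omega>. ?c (X (Suc n) \<omega>))"
    by (simp only: clip)
  also have "\<dots> = expectation (\<lambda>\<omega>. ?c (X n \<omega>)
      + p\<^sub>A * (X n \<omega> * (?c (X n \<omega> + \<gamma> * (1 - X n \<omega>)) - ?c (X n \<omega>)))
      + p\<^sub>B * ((1 - X n \<omega>) * (?c (X n \<omega> - \<gamma> * X n \<omega>) - ?c (X n \<omega>))))"
    unfolding X_def by (rule expectation_bandit_Suc[OF x, where K = 1]) auto
  also have "\<dots> = expectation (\<lambda>\<omega>. X n \<omega> + (p\<^sub>A - p\<^sub>B) * \<gamma> * (X n \<omega> * (1 - X n \<omega>)))"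
    unfolding clip by (rule Bochner_Integration.integral_cong) (auto simp: algebra_simps)
  also have "\<dots> = expectation (X n) + (p\<^sub>A - p\<^sub>B) * \<gamma> * expectation (\<lambda>\<omega>. X n \<omega> * (1 - X n \<omega>))"
    using int int' by simp
  finally show ?case
    using Suc.IH by (simp add: distrib_left)
qed

lemma AE_bandit_LIMSEQ:
  assumes x: "0 < \<gamma>" "\<gamma> < 1" "0 < x" "x \<le> 1" and p: "p\<^sub>B < p\<^sub>A"
  shows "AE \<omega> in M. (\<lambda>n. bandit U A B \<gamma> x n \<omega>) \<longlonglongrightarrow> 0 \<or> (\<lambda>n. bandit U A B \<gamma> x n \<omega>) \<longlonglongrightarrow> 1"
proof -
  define X where "X = bandit U A B \<gamma> x"
  have [measurable]: "X n \<in> borel_measurable M" for n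
    unfolding X_def by measurable
  have range: "0 \<le> X n \<omega>" "X n \<omega> \<le> 1" for n \<omega>
    using bandit_range[OF x] by (simp_all add: X_def less_imp_le)
  let ?q = "\<lambda>n \<omega>. X n \<omega> * (1 - X n \<omega>)"
  have q: "0 \<le> ?q n \<omega>" for n \<omega>
    using range by simp
  have int: "integrable M (?q n)" for n
    by (rule integrable_const_bound[where B = 1])
       (use range in \<open>auto simp: abs_mult intro!: mult_le_one\<close>)
  have "summable (\<lambda>n. expectation (?q n))"
  proof (rule summableI_nonneg_bounded)
    fix n
    show "0 \<le> expectation (?q n)"
      using q by (intro integral_nonneg_AE) auto
    \<comment> \<open>As \<open>X n\<close> stays in the unit interval, the drift identity bounds
      all partial sums by one constant.\<close>
    have "expectation (X n) \<le> 1"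
      by (rule integral_le_const[OF integrable_const_bound[where B = 1]]) (use range in auto)
    hence "(p\<^sub>A - p\<^sub>B) * \<gamma> * (\<Sum>k<n. expectation (?q k)) \<le> 1"
      using expectation_bandit_drift[OF x, of n] x by (simp add: X_def)
    thus "(\<Sum>k<n. expectation (?q k)) \<le> 1 / ((p\<^sub>A - p\<^sub>B) * \<gamma>)"
      using p x by (simp add: field_simps)
  qed
  \<comment> \<open>Exchanging sum and integral of nonnegative terms shows that the random series
    has finite expectation, hence is finite almost surely.\<close>
  hence "(\<Sum>n. ennreal (expectation (?q n))) \<noteq> top"
    by (intro ennreal_suminf_neq_top) (use q in \<open>auto intro!: integral_nonneg_AE\<close>)
  also have "(\<Sum>n. ennreal (expectation (?q n))) = (\<integral>\<^sup>+\<omega>. (\<Sum>n. ennreal (?q n \<omega>)) \<partial>M)"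
    using int q by (simp add: nn_integral_suminf nn_integral_eq_integral)
  finally have "AE \<omega> in M. (\<Sum>n. ennreal (?q n \<omega>)) \<noteq> \<infinity>"
    by (intro nn_integral_PInf_AE) auto
  thus ?thesis
  proof eventually_elim
    case (elim \<omega>)
    hence "summable (\<lambda>n. ?q n \<omega>)"
      using q by (intro summable_suminf_not_top) auto
    from summable_LIMSEQ_zero[OF this] show ?case
    proof (fold X_def, intro LIMSEQ_0_or_1[where \<gamma> = \<gamma>])
      fix n
      have "\<gamma> * (1 - X n \<omega>) \<le> \<gamma> * 1" "0 \<le> \<gamma> * (1 - X n \<omega>)" "\<gamma> * X n \<omega> \<le> \<gamma> * 1" "0 \<le> \<gamma> * X n \<omega>"
        using x range[of n \<omega>] by (auto intro!: mult_left_mono)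
      thus "\<bar>X (Suc n) \<omega> - X n \<omega>\<bar> \<le> \<gamma>"
        using x by (cases rule: bandit_Suc_cases[of \<gamma> x n \<omega>]) (auto simp: X_def)
    qed (use range x in auto)
  qed
qed

lemma AE_bandit_limit:
  assumes "0 < \<gamma>" "\<gamma> < 1" "0 < x" "x \<le> 1" "p\<^sub>B < p\<^sub>A"
  shows "AE \<omega> in M. (\<lambda>n. bandit U A B \<gamma> x n \<omega>) \<longlonglongrightarrow> bandit_limit U A B \<gamma> x \<omega> \<and>
    bandit_limit U A B \<gamma> x \<omega> \<in> {0, 1}"
  using AE_bandit_LIMSEQ[OF assms] unfolding bandit_limit_def
  by eventually_elim (metis insertCI limI)

lemma measurable_bandit_limit [measurable]: "bandit_limit U A B \<gamma> x \<in> borel_measurable M"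
  unfolding bandit_limit_def [abs_def] by measurable

text \<open>Here \<open>\<phi>\<close> of the process is a bounded supermartingale whose limit is the indicator of
  absorption at \<open>0\<close>.\<close>

lemma prob_bandit_limit_ge:
  assumes x: "0 < \<gamma>" "\<gamma> < 1" "0 < x" "x \<le> 1" and p: "p\<^sub>B < p\<^sub>A"
    and \<phi> [measurable]: "\<phi> \<in> borel_measurable borel" and bounds: "\<And>y. 0 \<le> \<phi> y \<and> \<phi> y \<le> (1 :: real)"
    and at_0: "(\<phi> \<longlongrightarrow> 1) (at_right 0)" and at_1: "isCont \<phi> 1" "\<phi> 1 = 0"
    and super: "\<And>y. 0 < y \<Longrightarrow> y \<le> 1 \<Longrightarrow>
      p\<^sub>A * (y * (\<phi> (y + \<gamma> * (1 - y)) - \<phi> y)) + p\<^sub>B * ((1 - y) * (\<phi> (y - \<gamma> * y) - \<phi> y)) \<le> 0"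
  shows "prob {\<omega> \<in> space M. bandit_limit U A B \<gamma> x \<omega> = 1} \<ge> 1 - \<phi> x"
proof -
  define X where "X = bandit U A B \<gamma> x"
  define L where "L = bandit_limit U A B \<gamma> x"
  have [measurable]: "X n \<in> borel_measurable M" "L \<in> borel_measurable M" for n
    unfolding X_def L_def by measurable
  have range: "0 < X n \<omega>" "X n \<omega> \<le> 1" for n \<omega>
    using bandit_range[OF x] by (simp_all add: X_def)
  have int: "integrable M (\<lambda>\<omega>. \<phi> (X n \<omega>))" for n
    by (rule integrable_const_bound[where B = 1]) (use bounds in auto)
  have le: "expectation (\<lambda>\<omega>. \<phi> (X n \<omega>)) \<le> \<phi> x" for n
  proof (induction n)
    case 0
    show ?case by (simp add: X_def prob_space)
  next
    case (Suc n)
    let ?T = "\<lambda>\<omega>. \<phi> (X n \<omega>)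
      + p\<^sub>A * (X n \<omega> * (\<phi> (X n \<omega> + \<gamma> * (1 - X n \<omega>)) - \<phi> (X n \<omega>)))
      + p\<^sub>B * ((1 - X n \<omega>) * (\<phi> (X n \<omega> - \<gamma> * X n \<omega>) - \<phi> (X n \<omega>)))"
    have "expectation (\<lambda>\<omega>. \<phi> (X (Suc n) \<omega>)) = expectation ?T"
      unfolding X_def by (rule expectation_bandit_Suc[OF x, where K = 1]) (use bounds in auto)
    also have "\<dots> \<le> expectation (\<lambda>\<omega>. \<phi> (X n \<omega>))"
    proof (rule integral_mono_AE')
      show "AE \<omega> in M. ?T \<omega> \<le> \<phi> (X n \<omega>)"
      proof (rule AE_I2)
        show "?T \<omega> \<le> \<phi> (X n \<omega>)" for \<omega>
          using super[OF range(1)[of n \<omega>] range(2)[of n \<omega>]] by linarith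
      qed
    qed (use int bounds in auto)
    finally show ?case using Suc.IH by simp
  qed
  have "(\<lambda>n. expectation (\<lambda>\<omega>. \<phi> (X n \<omega>))) \<longlonglongrightarrow> expectation (\<lambda>\<omega>. 1 - indicator {\<omega>. L \<omega> = 1} \<omega>)"
  proof (rule integral_dominated_convergence[where w = "\<lambda>_. 1"])
    show "AE \<omega> in M. (\<lambda>n. \<phi> (X n \<omega>)) \<longlonglongrightarrow> 1 - indicator {\<omega>. L \<omega> = 1} \<omega>"
      using AE_bandit_limit[OF x p] unfolding X_def[symmetric] L_def[symmetric]
    proof eventually_elim
      case (elim \<omega>)
      hence X_L: "(\<lambda>n. X n \<omega>) \<longlonglongrightarrow> L \<omega>" by blast
      from elim consider "L \<omega> = 0" | "L \<omega> = 1" by blast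
      thus ?case
      proof cases
        assume "L \<omega> = 0"
        \<comment> \<open>The state is positive at every finite time, so it approaches 0 from the
          right, where \<open>at_0\<close> gives the limit of \<open>\<phi>\<close>; the value
          \<open>\<phi> 0\<close> may differ from that limit.\<close>
        with X_L have "filterlim (\<lambda>n. X n \<omega>) (at_right 0) sequentially"
          by (auto simp: filterlim_at range less_imp_neq[OF range(1), symmetric])
        from filterlim_compose[OF at_0 this] \<open>L \<omega> = 0\<close> show ?thesis by simp
      next
        assume "L \<omega> = 1"
        with isCont_tendsto_compose[OF at_1(1), of "\<lambda>n. X n \<omega>"] X_L at_1(2) show ?thesis by simp
      qed
    qed
  qed (use bounds in auto)
  from LIMSEQ_le_const2[OF this] le
  have "expectation (\<lambda>\<omega>. 1 - indicator {\<omega>. L \<omega> = 1} \<omega>) \<le> \<phi> x" by blast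
  also have "expectation (\<lambda>\<omega>. 1 - indicator {\<omega>. L \<omega> = 1} \<omega>) =
      expectation (\<lambda>\<omega>. 1 - indicator {\<omega> \<in> space M. L \<omega> = 1} \<omega>)"
    by (rule Bochner_Integration.integral_cong) (auto simp: indicator_def)
  also have "\<dots> = 1 - prob {\<omega> \<in> space M. L \<omega> = 1}"
  proof -
    have S: "{\<omega> \<in> space M. L \<omega> = 1} \<in> events" by measurable
    hence "integrable M (indicator {\<omega> \<in> space M. L \<omega> = 1} :: 'a \<Rightarrow> real)"
      by (simp add: integrable_indicator_iff less_top[symmetric])
    thus ?thesis using S by (simp add: prob_space Int_absorb2)
  qed
  finally show ?thesis by (simp add: L_def)
qed

section \<open>Superharmonic functions and the quantitative bound\<close>

lemma prob_bandit_limit_bound: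
  assumes x: "0 < \<gamma>" "\<gamma> < 1" "0 < x" "x \<le> 1" and p: "0 \<le> p\<^sub>B" "p\<^sub>B < p\<^sub>A"
  shows "prob {\<omega> \<in> space M. bandit_limit U A B \<gamma> x \<omega> = 1}
    \<ge> 1 - 2 * p\<^sub>A * \<gamma> / ((p\<^sub>A - p\<^sub>B) * (1 - \<gamma>)\<^sup>2) * (1 / x - 1)"
proof -
  define c where "c = 2 * p\<^sub>A * \<gamma> / ((p\<^sub>A - p\<^sub>B) * (1 - \<gamma>)\<^sup>2)"
  have c: "0 < c" "c * ((p\<^sub>A - p\<^sub>B) * (1 - \<gamma>)\<^sup>2) = 2 * p\<^sub>A * \<gamma>"
    using x p by (auto simp: c_def)
  have move: "y \<le> y + \<gamma> * (1 - y)" "y + \<gamma> * (1 - y) \<le> 1" "0 < y - \<gamma> * y" "y - \<gamma> * y \<le> y"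
    if "0 < y" "y \<le> 1" for y
    using that x mult_left_le_one_le[of "1 - y" \<gamma>] by auto
  show ?thesis
  proof (cases "c \<ge> 1")
    case True
    \<comment> \<open>The truncated \<open>1 - y\<close> is superharmonic because the drift of the
      process is upward. It suffices here since
      \<open>1 - x \<le> 1 / x - 1 \<le> c * (1 / x - 1)\<close>.\<close>
    let ?\<phi> = "\<lambda>y::real. max 0 (min 1 (1 - y))"
    have "1 - ?\<phi> x \<le> prob {\<omega> \<in> space M. bandit_limit U A B \<gamma> x \<omega> = 1}"
    proof (rule prob_bandit_limit_ge[OF x p(2)])
      have "(?\<phi> \<longlongrightarrow> ?\<phi> 0) (at_right 0)"
        by (intro tendsto_intros)
      thus "(?\<phi> \<longlongrightarrow> 1) (at_right 0)" by simp
      show "p\<^sub>A * (y * (?\<phi> (y + \<gamma> * (1 - y)) - ?\<phi> y)) + p\<^sub>B * ((1 - y) * (?\<phi> (y - \<gamma> * y) - ?\<phi> y)) \<le> 0"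
        if y: "0 < y" "y \<le> 1" for y
      proof -
        have \<phi>: "?\<phi> z = 1 - z" if "0 \<le> z" "z \<le> 1" for z
          using that by simp
        have "?\<phi> (y + \<gamma> * (1 - y)) - ?\<phi> y = - (\<gamma> * (1 - y))" "?\<phi> (y - \<gamma> * y) - ?\<phi> y = \<gamma> * y"
          using move[OF y] y by (subst (1 2) \<phi>; linarith)+
        moreover have "p\<^sub>A * (y * - (\<gamma> * (1 - y))) + p\<^sub>B * ((1 - y) * (\<gamma> * y)) = - ((p\<^sub>A - p\<^sub>B) * (\<gamma> * y * (1 - y)))"
          by (simp add: algebra_simps)
        moreover have "0 \<le> (p\<^sub>A - p\<^sub>B) * (\<gamma> * y * (1 - y))"
          using x p y by simp
        ultimately show ?thesis by simp
      qed
    qed (auto intro!: continuous_intros)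
    moreover have "?\<phi> x \<le> c * (1 / x - 1)"
    proof -
      have "?\<phi> x \<le> 1 / x - 1"
      proof -
        have "0 \<le> (1 - x) * (1 - x)" by simp
        hence "1 - x \<le> 1 / x - 1" using x by (simp add: field_simps)
        thus ?thesis using x by simp
      qed
      also have "1 / x - 1 \<le> c * (1 / x - 1)"
        using True x mult_right_mono[of 1 c "1 / x - 1"] by simp
      finally show ?thesis .
    qed
    ultimately show ?thesis unfolding c_def[symmetric] by linarith
  next
    case False
    let ?\<psi> = "\<lambda>y::real. c * (1 / y - 1)"
    \<comment> \<open>Near 0 from the right this function equals 1, although at 0 itself the
      convention \<open>1 / 0 = 0\<close> makes it 0.\<close>
    let ?\<phi> = "\<lambda>y::real. max 0 (min 1 (?\<psi> y))"
    have "(1 - \<gamma>)\<^sup>2 \<le> 1"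
      using x by (simp add: power_le_one)
    hence sq: "(p\<^sub>A - p\<^sub>B) * (1 - \<gamma>)\<^sup>2 \<le> p\<^sub>A - p\<^sub>B"
      using p mult_left_le[of "(1 - \<gamma>)\<^sup>2" "p\<^sub>A - p\<^sub>B"] by simp
    \<comment> \<open>With \<open>c < 1\<close>, the definition of \<open>c\<close> forces \<gamma>
      to be small relative to the gap between the two probabilities; this is one of the two
      estimates behind the final sign.\<close>
    have "c * ((p\<^sub>A - p\<^sub>B) * (1 - \<gamma>)\<^sup>2) \<le> 1 * ((p\<^sub>A - p\<^sub>B) * (1 - \<gamma>)\<^sup>2)"
      using False p by (intro mult_right_mono) auto
    hence small: "2 * (p\<^sub>A * \<gamma>) \<le> p\<^sub>A - p\<^sub>B"
      using c sq by simp
    have "1 - ?\<phi> x \<le> prob {\<omega> \<in> space M. bandit_limit U A B \<gamma> x \<omega> = 1}"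
    proof (rule prob_bandit_limit_ge[OF x p(2)])
      have "eventually (\<lambda>y. ?\<phi> y = 1) (at_right 0)"
      \<comment> \<open>The point \<open>c / (1 + c)\<close> is where \<open>c * (1 / y - 1)\<close>
        takes the value 1.\<close>
      proof (rule eventually_at_rightI[of 0 "c / (1 + c)"])
        fix y assume "y \<in> {0<..<c / (1 + c)}"
        hence "1 \<le> ?\<psi> y" using c by (simp add: field_simps)
        thus "?\<phi> y = 1" by simp
      qed (use c in simp)
      thus "(?\<phi> \<longlongrightarrow> 1) (at_right 0)" by (rule tendsto_eventually)
      show "p\<^sub>A * (y * (?\<phi> (y + \<gamma> * (1 - y)) - ?\<phi> y)) + p\<^sub>B * ((1 - y) * (?\<phi> (y - \<gamma> * y) - ?\<phi> y)) \<le> 0"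
        if y: "0 < y" "y \<le> 1" for y
      proof (cases "?\<psi> y \<ge> 1")
        \<comment> \<open>Here the truncated function is at its maximum 1, so neither move can
          increase it.\<close>
        case True
        hence "?\<phi> (y + \<gamma> * (1 - y)) - ?\<phi> y \<le> 0" "?\<phi> (y - \<gamma> * y) - ?\<phi> y \<le> 0"
          by auto
        thus ?thesis
          using p y by (intro add_nonpos_nonpos mult_nonneg_nonpos) auto
      next
        case False
        let ?u = "y + \<gamma> * (1 - y)" and ?d = "y - \<gamma> * y"
        have "0 \<le> ?\<psi> z" if "0 < z" "z \<le> 1" for z
          using that c by simp
        \<comment> \<open>At \<open>y\<close> the truncation has no effect, and at the two targets
          it can only lower the nonnegative value of \<open>?\<psi>\<close>; so
          \<open>?\<psi>\<close> may replace \<open>?\<phi>\<close> in an upper bound.\<close>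
        from this[of y] this[of ?u] this[of ?d] False
        have "?\<phi> ?u - ?\<phi> y \<le> ?\<psi> ?u - ?\<psi> y" "?\<phi> ?d - ?\<phi> y \<le> ?\<psi> ?d - ?\<psi> y"
          using move[OF y] y by linarith+
        hence "p\<^sub>A * (y * (?\<phi> ?u - ?\<phi> y)) + p\<^sub>B * ((1 - y) * (?\<phi> ?d - ?\<phi> y)) \<le>
            p\<^sub>A * (y * (?\<psi> ?u - ?\<psi> y)) + p\<^sub>B * ((1 - y) * (?\<psi> ?d - ?\<psi> y))"
          using p y by (intro add_mono mult_left_mono) auto
        also have "\<dots> = c * \<gamma> * (1 - y) * (p\<^sub>B * ?u - p\<^sub>A * (1 - \<gamma>) * y) / (y * ?u * (1 - \<gamma>))"
        proof -
          have "?u > 0" using move[OF y] y by linarith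
          have "?\<psi> ?u - ?\<psi> y = - (c * \<gamma> * (1 - y)) / (y * ?u)"
            using \<open>?u > 0\<close> y by (simp add: divide_simps) (simp add: algebra_simps)
          moreover have "?\<psi> ?d - ?\<psi> y = c * \<gamma> / (y * (1 - \<gamma>))"
          proof -
            have "?d = y * (1 - \<gamma>)" by (simp add: algebra_simps)
            thus ?thesis using x y by (simp only:) (simp add: divide_simps, simp add: algebra_simps)
          qed
          ultimately show ?thesis
            using \<open>?u > 0\<close> x y by (simp only:) (simp add: divide_simps, simp add: algebra_simps)
        qed
        \<comment> \<open>The sign is that of
          \<open>p\<^sub>B * ?u - p\<^sub>A * (1 - \<gamma>) * y\<close>, so the claim is
          \<open>p\<^sub>B * \<gamma> * (1 - y) + p\<^sub>A * \<gamma> * y \<le> (p\<^sub>A -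
          p\<^sub>B) * y\<close>. Each summand on the left is at most half of the right side: the
          first since \<open>?\<psi> y < 1\<close>, the second by \<open>small\<close>. This is the
          origin of the factor 2 in \<open>c\<close>.\<close>
        also have "\<dots> \<le> 0"
        proof -
          have "c * (1 - y) \<le> y"
            using False y by (simp add: field_simps)
          hence "c * (1 - y) * ((p\<^sub>A - p\<^sub>B) * (1 - \<gamma>)\<^sup>2) \<le> y * ((p\<^sub>A - p\<^sub>B) * (1 - \<gamma>)\<^sup>2)"
            using p by (intro mult_right_mono) auto
          moreover have "c * (1 - y) * ((p\<^sub>A - p\<^sub>B) * (1 - \<gamma>)\<^sup>2) = 2 * p\<^sub>A * \<gamma> * (1 - y)"
            by (simp add: c(2)[symmetric])
          moreover have "y * ((p\<^sub>A - p\<^sub>B) * (1 - \<gamma>)\<^sup>2) \<le> y * (p\<^sub>A - p\<^sub>B)"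
            using sq y by (intro mult_left_mono) auto
          ultimately have "2 * p\<^sub>A * \<gamma> * (1 - y) \<le> y * (p\<^sub>A - p\<^sub>B)"
            by linarith
          hence "2 * (p\<^sub>A * (\<gamma> * (1 - y))) \<le> y * (p\<^sub>A - p\<^sub>B)"
            by (simp only: mult.assoc)
          moreover have "p\<^sub>B * (\<gamma> * (1 - y)) \<le> p\<^sub>A * (\<gamma> * (1 - y))"
            using p x y by (intro mult_right_mono) auto
          moreover have "y * (2 * (p\<^sub>A * \<gamma>)) \<le> y * (p\<^sub>A - p\<^sub>B)"
            using small y by (intro mult_left_mono) auto
          ultimately have "p\<^sub>B * ?u \<le> p\<^sub>A * (1 - \<gamma>) * y"
            by (simp add: algebra_simps)
          moreover have "0 < ?u" using move[OF y] y by linarith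
          ultimately show ?thesis
            using c x y by (intro divide_nonpos_pos mult_nonneg_nonpos mult_pos_pos) auto
        qed
        finally show ?thesis .
      qed
    qed (auto intro!: continuous_intros)
    moreover have "?\<phi> x \<le> ?\<psi> x"
      using c x by simp
    ultimately show ?thesis unfolding c_def[symmetric] by linarith
  qed
qed

end

section \<open>The bound for every step size, and vanishing step size\<close>

theorem theorem2:
  fixes M :: "'a measure"
    and U :: "nat \<Rightarrow> 'a \<Rightarrow> real"
    and A B :: "nat \<Rightarrow> 'a set"
    and p\<^sub>A p\<^sub>B \<pi> x :: real
  assumes "bandit_inputs M U A B p\<^sub>A p\<^sub>B"
    and "0 \<le> p\<^sub>B" and "p\<^sub>B < p\<^sub>A" and "p\<^sub>A \<le> 1"
    and "\<pi> = p\<^sub>A - p\<^sub>B"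
    and "0 < x" and "x \<le> 1"
  shows "(\<forall>\<gamma>. 0 < \<gamma> \<and> \<gamma> < 1 \<longrightarrow>
           (AE \<omega> in M. (\<lambda>n. bandit U A B \<gamma> x n \<omega>) \<longlonglongrightarrow> bandit_limit U A B \<gamma> x \<omega>) \<and>
           measure M {\<omega> \<in> space M. bandit_limit U A B \<gamma> x \<omega> = 1}
             \<ge> 1 - 2 * p\<^sub>A * \<gamma> / (\<pi> * (1 - \<gamma>)\<^sup>2) * (1 / x - 1))
       \<and> ((\<lambda>\<gamma>. measure M {\<omega> \<in> space M. bandit_limit U A B \<gamma> x \<omega> = 1}) \<longlongrightarrow> 1) (at_right 0)"
proof -
  interpret bandit_inputs M U A B p\<^sub>A p\<^sub>B by fact
  let ?P = "\<lambda>\<gamma>. measure M {\<omega> \<in> space M. bandit_limit U A B \<gamma> x \<omega> = 1}"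
  let ?b = "\<lambda>\<gamma>. 1 - 2 * p\<^sub>A * \<gamma> / (\<pi> * (1 - \<gamma>)\<^sup>2) * (1 / x - 1)"
  have bound: "?b \<gamma> \<le> ?P \<gamma>" if "0 < \<gamma>" "\<gamma> < 1" for \<gamma>
    using prob_bandit_limit_bound[OF that assms(6,7,2,3)] assms(5) by simp
  have "(?P \<longlongrightarrow> 1) (at_right 0)"
  proof (rule tendsto_sandwich)
    \<comment> \<open>The subtracted term carries a factor \<gamma>, while its denominator tends to
      \<pi> > 0.\<close>
    show "(?b \<longlongrightarrow> 1) (at_right 0)"
      using assms(3,5) by (auto intro!: tendsto_eq_intros)
    show "eventually (\<lambda>\<gamma>. ?b \<gamma> \<le> ?P \<gamma>) (at_right 0)"
      by (rule eventually_at_rightI[of 0 1]) (use bound in auto)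
    show "eventually (\<lambda>\<gamma>. ?P \<gamma> \<le> 1) (at_right 0)"
      by simp
  qed simp
  moreover have "AE \<omega> in M. (\<lambda>n. bandit U A B \<gamma> x n \<omega>) \<longlonglongrightarrow> bandit_limit U A B \<gamma> x \<omega>"
    if "0 < \<gamma>" "\<gamma> < 1" for \<gamma>
    using AE_bandit_limit[OF that assms(6,7,3)] by eventually_elim blast
  ultimately show ?thesis
    using bound by blast
qed

end
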